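(* Let $n>2$. There is a group isomorphism $C(n,2)\rtimes S_n\to G_n^2\rtimes S_n$ which takes $(b_{ij},1)$ to $(a_{ij},(i\,j))$ for each transposition $(i\,j)$ and takes $(1,\sigma)$ to $(1,\sigma)$ for each $\sigma\in S_n$. Hence $G_n^2$ (identified with $G_n^2\times\{1\}\subset G_n^2\rtimes S_n$ and transported by this isomorphism) is a normal subgroup of $C(n,2)\rtimes S_n$.
   Context: Let $n>2$. Generators are indexed by unordered pairs of distinct elements of $\{1,\dots,n\}$ (so $a_{ij}=a_{ji}$, $b_{ij}=b_{ji}$). The group $G_n^2$ has generators $a_{ij}$ and defining relations: $a_{ij}a_{ik}a_{jk}=a_{jk}a_{ik}a_{ij}$ for all distinct $i,j,k$; $a_{ij}a_{kl}=a_{kl}a_{ij}$ for all pairwise distinct $i,j,k,l$; $a_{ij}^2=1$ for all $i\neq j$. The Coxeter group $C(n,2)$ has generators $b_{ij}$ and defining relations: $(b_{ij}b_{ik})^3=1$ for all distinct $i,j,k$; $b_{ij}b_{kl}=b_{kl}b_{ij}$ for all pairwise distinct $i,j,k,l$; $b_{ij}^2=1$ for all $i\ne j$. The symmetric group $S_n$ acts on $G_n^2$ and on $C(n,2)$ by automorphisms permuting the indices of the generators: $\sigma\cdot a_{ij}=a_{\sigma(i)\sigma(j)}$ and $\sigma\cdot b_{ij}=b_{\sigma(i)\sigma(j)}$. The semidirect products $G_n^2\rtimes S_n$ and $C(n,2)\rtimes S_n$ are formed with respect to these actions: elements are pairs $(g,\sigma)$ with $(g,\sigma)(h,\tau)=(g\,(\sigma\cdot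 h),\sigma\tau)$, where here $\sigma\tau$ is the usual composition of permutations, $(\sigma\tau)(x)=\sigma(\tau(x))$. *)

theory Defs
  imports "HOL-Algebra.Sym_Groups" "HOL-Algebra.Bij"
begin

section \<open>Groups given by generators and relations\<close>

text \<open>A letter \<open>(g, True)\<close> stands for the generator \<open>g\<close> and \<open>(g, False)\<close> for its formal
  inverse. The group presented by generators \<open>S\<close> and relations \<open>u = v\<close>, \<open>(u, v) \<in> R\<close>, consists of
  the words over \<open>S\<close> modulo the congruence generated by \<open>R\<close> and by cancellation of a letter against
  its formal inverse.\<close>

type_synonym 'g word = "('g \<times> bool) list"

definition words :: "'g set \<Rightarrow> 'g word set" where
  "words S = lists (S \<times> UNIV)"

inductive word_cong :: "'g set \<Rightarrow> ('g word \<times> 'g word) set \<Rightarrow> 'g word \<Rightarrow> 'g word \<Rightarrow> bool"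
  for S R where
  refl: "w \<in> words S \<Longrightarrow> word_cong S R w w"
| sym: "word_cong S R u v \<Longrightarrow> word_cong S R v u"
| trans: "word_cong S R u v \<Longrightarrow> word_cong S R v w \<Longrightarrow> word_cong S R u w"
| append: "word_cong S R u u' \<Longrightarrow> word_cong S R v v' \<Longrightarrow> word_cong S R (u @ v) (u' @ v')"
| cancel: "g \<in> S \<Longrightarrow> word_cong S R [(g, b), (g, \<not> b)] []"
| rel: "(u, v) \<in> R \<Longrightarrow> u \<in> words S \<Longrightarrow> v \<in> words S \<Longrightarrow> word_cong S R u v"

definition word_class :: "'g set \<Rightarrow> ('g word \<times> 'g word) set \<Rightarrow> 'g word \<Rightarrow> 'g word set" where
  "word_class S R w = {v. word_cong S R w v}"

definition presented_group :: "'g set \<Rightarrow> ('g word \<times> 'g word) set \<Rightarrow> 'g word set monoid" where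
  "presented_group S R =
     \<lparr> carrier = word_class S R ` words S,
       mult = (\<lambda>X Y. \<Union>u\<in>X. \<Union>v\<in>Y. word_class S R (u @ v)),
       one = word_class S R [] \<rparr>"

lemma words_simps [simp]:
  "[] \<in> words S"
  "x # u \<in> words S \<longleftrightarrow> fst x \<in> S \<and> u \<in> words S"
  "u @ v \<in> words S \<longleftrightarrow> u \<in> words S \<and> v \<in> words S"
  by (cases x; auto simp: words_def)+

lemma word_cong_words:
  "word_cong S R u v \<Longrightarrow> u \<in> words S \<and> v \<in> words S"
  by (induction rule: word_cong.induct) auto

lemma word_class_eq_iff:
  assumes "u \<in> words S"
  shows "word_class S R u = word_class S R v \<longleftrightarrow> word_cong S R u v"
  using assms unfolding word_class_def
  by (auto intro: word_cong.intros)

lemma presented_group_mult: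
  assumes "u \<in> words S" "v \<in> words S"
  shows "word_class S R u \<otimes>\<^bsub>presented_group S R\<^esub> word_class S R v = word_class S R (u @ v)"
  using assms unfolding presented_group_def word_class_def
  by (auto intro: word_cong.intros)

lemma presented_group_carrier: "carrier (presented_group S R) = word_class S R ` words S"
  and presented_group_one: "\<one>\<^bsub>presented_group S R\<^esub> = word_class S R []"
  by (simp_all add: presented_group_def)

definition word_inv :: "'g word \<Rightarrow> 'g word" where
  "word_inv w = rev (map (map_prod id Not) w)"

lemma word_inv_words [simp]: "word_inv w \<in> words S \<longleftrightarrow> w \<in> words S"
  by (induction w) (auto simp: word_inv_def)

lemma word_cong_word_inv: "w \<in> words S \<Longrightarrow> word_cong S R (word_inv w @ w) []"
proof (induction w)
  case Nil
  then show ?case by (simp add: word_inv_def word_cong.refl)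
next
  case (Cons x w)
  obtain g b where x: "x = (g, b)" by (cases x)
  have inv: "word_cong S R (word_inv w) (word_inv w)" and w: "word_cong S R w w"
    using Cons.prems by (auto intro: word_cong.refl)
  have "word_cong S R [(g, \<not> b), (g, b)] []"
    using word_cong.cancel[of g S R "\<not> b"] Cons.prems x by simp
  from word_cong.append[OF inv word_cong.append[OF this w]]
  have "word_cong S R (word_inv (x # w) @ x # w) (word_inv w @ w)"
    by (simp add: word_inv_def x)
  with Cons show ?case by (auto intro: word_cong.trans)
qed

lemma group_presented_group: "group (presented_group S R)"
proof (rule groupI)
  fix X assume "X \<in> carrier (presented_group S R)"
  then obtain w where w: "w \<in> words S" "X = word_class S R w"
    by (auto simp: presented_group_carrier)
  then have "word_class S R (word_inv w) \<otimes>\<^bsub>presented_group S R\<^esub> X = \<one>\<^bsub>presented_group S R\<^esub>"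
    by (simp add: presented_group_mult presented_group_one word_class_eq_iff word_cong_word_inv)
  with w show "\<exists>Y\<in>carrier (presented_group S R). Y \<otimes>\<^bsub>presented_group S R\<^esub> X = \<one>\<^bsub>presented_group S R\<^esub>"
    by (auto simp: presented_group_carrier)
qed (auto simp: presented_group_carrier presented_group_mult presented_group_one)

definition presented_gen :: "'g set \<Rightarrow> ('g word \<times> 'g word) set \<Rightarrow> 'g \<Rightarrow> 'g word set" where
  "presented_gen S R g = word_class S R [(g, True)]"

definition word_eval :: "('h, 'm) monoid_scheme \<Rightarrow> ('g \<Rightarrow> 'h) \<Rightarrow> 'g word \<Rightarrow> 'h" where
  "word_eval H f w =
     foldr (\<lambda>(g, b) y. (if b then f g else inv\<^bsub>H\<^esub> f g) \<otimes>\<^bsub>H\<^esub> y) w \<one>\<^bsub>H\<^esub>"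

lemma presented_group_universal:
  assumes "group H" and f: "f \<in> S \<rightarrow> carrier H"
    and rels: "\<And>u v. (u, v) \<in> R \<Longrightarrow> u \<in> words S \<Longrightarrow> v \<in> words S \<Longrightarrow> word_eval H f u = word_eval H f v"
  shows "\<exists>h\<in>hom (presented_group S R) H. \<forall>g\<in>S. h (presented_gen S R g) = f g"
proof -
  interpret H: group H by fact
  have closed: "w \<in> words S \<Longrightarrow> word_eval H f w \<in> carrier H" for w
  proof (induction w)
    case (Cons x w)
    then show ?case using f by (cases x) (auto simp: word_eval_def)
  qed (simp add: word_eval_def)
  have app: "u \<in> words S \<Longrightarrow> v \<in> words S \<Longrightarrow>
      word_eval H f (u @ v) = word_eval H f u \<otimes>\<^bsub>H\<^esub> word_eval H f v" for u v
  proof (induction u)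
    case Nil
    then show ?case using closed[of v] by (simp add: word_eval_def)
  next
    case (Cons x u)
    then have x: "f (fst x) \<in> carrier H" using f by auto
    have "word_eval H f ((x # u) @ v) =
        (if snd x then f (fst x) else inv\<^bsub>H\<^esub> f (fst x)) \<otimes>\<^bsub>H\<^esub> word_eval H f (u @ v)"
      by (cases x) (simp add: word_eval_def)
    also have "\<dots> = ((if snd x then f (fst x) else inv\<^bsub>H\<^esub> f (fst x)) \<otimes>\<^bsub>H\<^esub> word_eval H f u)
        \<otimes>\<^bsub>H\<^esub> word_eval H f v"
      using Cons x closed[of u] closed[of v] by (simp add: H.m_assoc)
    finally show ?case by (cases x) (simp add: word_eval_def)
  qed
  have cong: "word_cong S R u v \<Longrightarrow> word_eval H f u = word_eval H f v" for u v
  proof (induction rule: word_cong.induct)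
    case (append u u' v v')
    then show ?case using app word_cong_words by metis
  next
    case (cancel g b)
    then have "f g \<in> carrier H" using f by auto
    then show ?case by (cases b) (simp_all add: word_eval_def)
  qed (use rels in auto)
  define h where "h X = word_eval H f (SOME w. w \<in> X)" for X
  have h: "h (word_class S R w) = word_eval H f w" if "w \<in> words S" for w
  proof -
    have "w \<in> word_class S R w"
      using that by (auto simp: word_class_def intro: word_cong.refl)
    then have "(SOME v. v \<in> word_class S R w) \<in> word_class S R w"
      by (rule someI)
    then show ?thesis by (auto simp: h_def word_class_def dest: cong)
  qed
  show ?thesis
  proof (rule bexI[of _ h])
    show "h \<in> hom (presented_group S R) H"
      by (rule homI) (auto simp: presented_group_carrier presented_group_mult h closed app)
    show "\<forall>g\<in>S. h (presented_gen S R g) = f g"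
      using f by (auto simp: presented_gen_def h word_eval_def Pi_iff)
  qed
qed

lemma presented_gen_carrier: "g \<in> S \<Longrightarrow> presented_gen S R g \<in> carrier (presented_group S R)"
  by (auto simp: presented_gen_def presented_group_carrier)

lemma presented_gen_inv:
  assumes "g \<in> S"
  shows "word_class S R [(g, False)] = inv\<^bsub>presented_group S R\<^esub> presented_gen S R g"
proof -
  interpret group "presented_group S R" by (rule group_presented_group)
  have "word_cong S R [(g, False), (g, True)] []"
    using word_cong.cancel[of g S R False] assms by simp
  then have "word_class S R [(g, False)] \<otimes>\<^bsub>presented_group S R\<^esub> presented_gen S R g
      = \<one>\<^bsub>presented_group S R\<^esub>"
    using assms
    by (simp add: presented_gen_def presented_group_mult presented_group_one word_class_eq_iff)
  then show ?thesis
    using assms by (intro inv_equality[symmetric])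
      (simp_all add: presented_gen_carrier, simp add: presented_group_carrier)
qed

lemma presented_group_hom_unique:
  assumes "group H" "h \<in> hom (presented_group S R) H" "k \<in> hom (presented_group S R) H"
    and eq: "\<And>g. g \<in> S \<Longrightarrow> h (presented_gen S R g) = k (presented_gen S R g)"
    and "X \<in> carrier (presented_group S R)"
  shows "h X = k X"
proof -
  interpret P: group "presented_group S R" by (rule group_presented_group)
  interpret h: group_hom "presented_group S R" H h
    using assms by (simp add: group_hom_def group_hom_axioms_def group_presented_group)
  interpret k: group_hom "presented_group S R" H k
    using assms by (simp add: group_hom_def group_hom_axioms_def group_presented_group)
  obtain w where w: "w \<in> words S" "X = word_class S R w"
    using assms(5) by (auto simp: presented_group_carrier)
  from w(1) have "h (word_class S R w) = k (word_class S R w)"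
  proof (induction w)
    case Nil
    then show ?case using h.hom_one k.hom_one by (simp add: presented_group_one)
  next
    case (Cons x w)
    obtain g b where x: "x = (g, b)" by (cases x)
    then have g: "g \<in> S" and w: "w \<in> words S" using Cons.prems by auto
    have "word_class S R (x # w) =
        word_class S R [x] \<otimes>\<^bsub>presented_group S R\<^esub> word_class S R w"
      using presented_group_mult[of "[x]" S w R] Cons.prems by simp
    moreover have "h (word_class S R [x]) = k (word_class S R [x])"
      using eq[OF g] g
      by (cases b)
        (simp_all add: x presented_gen_inv presented_gen_carrier flip: presented_gen_def)
    moreover have "word_class S R [x] \<in> carrier (presented_group S R)"
      "word_class S R w \<in> carrier (presented_group S R)"
      using g w x by (auto simp: presented_group_carrier)
    ultimately show ?case using Cons.IH w by simp
  qed
  with w(2) show ?thesis by simp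
qed

text \<open>A permutation \<open>f\<close> of the generators that preserves the relations acts letterwise on words, and
  hence on congruence classes of words by taking images.\<close>

definition relabel_word :: "('g \<Rightarrow> 'g) \<Rightarrow> 'g word \<Rightarrow> 'g word" where
  "relabel_word f = map (map_prod f id)"

definition relabel ::
    "'g set \<Rightarrow> ('g word \<times> 'g word) set \<Rightarrow> ('g \<Rightarrow> 'g) \<Rightarrow> 'g word set \<Rightarrow> 'g word set" where
  "relabel S R f = (\<lambda>X\<in>carrier (presented_group S R). relabel_word f ` X)"

lemma relabel_word_simps [simp]:
  "relabel_word f [] = []"
  "relabel_word f ((g, b) # w) = (f g, b) # relabel_word f w"
  "relabel_word f (u @ v) = relabel_word f u @ relabel_word f v"
  by (simp_all add: relabel_word_def)

lemma relabel_word_words: "f ` S \<subseteq> S \<Longrightarrow> w \<in> words S \<Longrightarrow> relabel_word f w \<in> words S"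
  by (induction w) (auto simp: relabel_word_def)

lemma word_cong_relabel_word:
  assumes "f ` S \<subseteq> S" "\<And>u v. (u, v) \<in> R \<Longrightarrow> (relabel_word f u, relabel_word f v) \<in> R"
  shows "word_cong S R u v \<Longrightarrow> word_cong S R (relabel_word f u) (relabel_word f v)"
proof (induction rule: word_cong.induct)
  case (rel u v)
  then show ?case using assms by (intro word_cong.rel) (auto simp: relabel_word_words)
next
  case (refl w)
  then show ?case using assms(1) by (intro word_cong.refl relabel_word_words)
next
  case (cancel g b)
  then show ?case using assms(1) word_cong.cancel[of "f g" S R b] by auto
qed (auto intro: word_cong.intros)

lemma relabel_word_class:
  assumes "f ` S \<subseteq> S" "\<And>u v. (u, v) \<in> R \<Longrightarrow> (relabel_word f u, relabel_word f v) \<in> R"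
    and "f' ` S \<subseteq> S" "\<And>u v. (u, v) \<in> R \<Longrightarrow> (relabel_word f' u, relabel_word f' v) \<in> R"
    and "f \<circ> f' = id" "f' \<circ> f = id" and w: "w \<in> words S"
  shows "relabel S R f (word_class S R w) = word_class S R (relabel_word f w)"
proof -
  have ff': "relabel_word f (relabel_word f' u) = u"
    and f'f: "relabel_word f' (relabel_word f u) = u" for u
    using assms(5,6) by (simp_all add: relabel_word_def prod.map_comp prod.map_id0 o_def fun_eq_iff
      split_beta map_idI)
  have "relabel_word f ` word_class S R w = word_class S R (relabel_word f w)"
  proof (intro equalityI subsetI)
    fix v assume "v \<in> relabel_word f ` word_class S R w"
    then show "v \<in> word_class S R (relabel_word f w)"
      using word_cong_relabel_word[OF assms(1,2)] by (auto simp: word_class_def)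
  next
    fix v assume "v \<in> word_class S R (relabel_word f w)"
    then have "word_cong S R (relabel_word f' (relabel_word f w)) (relabel_word f' v)"
      using word_cong_relabel_word[OF assms(3,4)] by (auto simp: word_class_def)
    then have "relabel_word f' v \<in> word_class S R w" by (simp add: f'f word_class_def)
    then have "relabel_word f (relabel_word f' v) \<in> relabel_word f ` word_class S R w"
      by (rule imageI)
    then show "v \<in> relabel_word f ` word_class S R w" by (simp add: ff')
  qed
  then show ?thesis using w by (simp add: relabel_def presented_group_carrier)
qed


section \<open>Semidirect products\<close>

definition semidirect ::
    "('a, 'm) monoid_scheme \<Rightarrow> ('b, 'k) monoid_scheme \<Rightarrow> ('b \<Rightarrow> 'a \<Rightarrow> 'a) \<Rightarrow> ('a \<times> 'b) monoid" where
  "semidirect G H \<phi> =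
     \<lparr> carrier = carrier G \<times> carrier H,
       mult = (\<lambda>(g, s) (h, t). (g \<otimes>\<^bsub>G\<^esub> \<phi> s h, s \<otimes>\<^bsub>H\<^esub> t)),
       one = (\<one>\<^bsub>G\<^esub>, \<one>\<^bsub>H\<^esub>) \<rparr>"

lemma semidirect_simps [simp]:
  "carrier (semidirect G H \<phi>) = carrier G \<times> carrier H"
  "(g, s) \<otimes>\<^bsub>semidirect G H \<phi>\<^esub> (h, t) = (g \<otimes>\<^bsub>G\<^esub> \<phi> s h, s \<otimes>\<^bsub>H\<^esub> t)"
  "\<one>\<^bsub>semidirect G H \<phi>\<^esub> = (\<one>\<^bsub>G\<^esub>, \<one>\<^bsub>H\<^esub>)"
  by (simp_all add: semidirect_def)

lemma AutoGroup_hom_facts: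
  assumes "group G" "group H" "\<phi> \<in> hom H (AutoGroup G)"
  shows "\<And>s. s \<in> carrier H \<Longrightarrow> \<phi> s \<in> hom G G"
    and "\<And>s g. s \<in> carrier H \<Longrightarrow> g \<in> carrier G \<Longrightarrow> \<phi> s g \<in> carrier G"
    and "\<And>s t g. s \<in> carrier H \<Longrightarrow> t \<in> carrier H \<Longrightarrow> g \<in> carrier G \<Longrightarrow>
           \<phi> (s \<otimes>\<^bsub>H\<^esub> t) g = \<phi> s (\<phi> t g)"
    and "\<And>g. g \<in> carrier G \<Longrightarrow> \<phi> \<one>\<^bsub>H\<^esub> g = g"
proof -
  have auto: "\<phi> s \<in> auto G" if "s \<in> carrier H" for s
    using hom_in_carrier[OF assms(3) that] by (simp add: AutoGroup_def)
  then show "\<And>s. s \<in> carrier H \<Longrightarrow> \<phi> s \<in> hom G G" by (auto simp: auto_def)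
  then show closed: "\<And>s g. s \<in> carrier H \<Longrightarrow> g \<in> carrier G \<Longrightarrow> \<phi> s g \<in> carrier G"
    by (blast intro: hom_in_carrier)
  show "\<phi> (s \<otimes>\<^bsub>H\<^esub> t) g = \<phi> s (\<phi> t g)"
    if "s \<in> carrier H" "t \<in> carrier H" "g \<in> carrier G" for s t g
    using hom_mult[OF assms(3) that(1,2)] that auto[OF that(1)] auto[OF that(2)]
    by (simp add: AutoGroup_def BijGroup_def auto_def compose_eq)
  have "\<phi> \<one>\<^bsub>H\<^esub> = \<one>\<^bsub>AutoGroup G\<^esub>"
    using assms by (intro hom_one) (auto simp: group.AutoGroup)
  then show "\<And>g. g \<in> carrier G \<Longrightarrow> \<phi> \<one>\<^bsub>H\<^esub> g = g"
    by (simp add: AutoGroup_def BijGroup_def)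
qed

lemma group_semidirect:
  assumes "group G" "group H" "\<phi> \<in> hom H (AutoGroup G)"
  shows "group (semidirect G H \<phi>)"
proof -
  interpret G: group G by fact
  interpret H: group H by fact
  note \<phi> = AutoGroup_hom_facts[OF assms]
  have inv: "\<exists>y\<in>carrier (semidirect G H \<phi>). y \<otimes>\<^bsub>semidirect G H \<phi>\<^esub> (g, s) = \<one>\<^bsub>semidirect G H \<phi>\<^esub>"
    if "g \<in> carrier G" "s \<in> carrier H" for g s
  proof (rule bexI[of _ "(inv\<^bsub>G\<^esub> \<phi> (inv\<^bsub>H\<^esub> s) g, inv\<^bsub>H\<^esub> s)"])
  qed (use that \<phi>(2) in auto)
  show ?thesis
  proof (rule groupI)
    fix x y z
    assume "x \<in> carrier (semidirect G H \<phi>)" "y \<in> carrier (semidirect G H \<phi>)"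
      "z \<in> carrier (semidirect G H \<phi>)"
    then show "x \<otimes>\<^bsub>semidirect G H \<phi>\<^esub> y \<otimes>\<^bsub>semidirect G H \<phi>\<^esub> z =
        x \<otimes>\<^bsub>semidirect G H \<phi>\<^esub> (y \<otimes>\<^bsub>semidirect G H \<phi>\<^esub> z)"
      using \<phi> by (auto simp: G.m_assoc H.m_assoc hom_mult[of "\<phi> _" G G])
  qed (use \<phi> inv in auto)
qed


section \<open>The groups $G_n^2$ and $C(n,2)$\<close>

definition index_pairs :: "nat \<Rightarrow> nat set set" where
  "index_pairs n = {{i, j} | i j. i \<in> {1..n} \<and> j \<in> {1..n} \<and> i \<noteq> j}"

definition letter :: "nat \<Rightarrow> nat \<Rightarrow> nat set \<times> bool" where
  "letter i j = ({i, j}, True)"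

definition distinct_indices :: "nat \<Rightarrow> nat list \<Rightarrow> bool" where
  "distinct_indices n is \<longleftrightarrow> distinct is \<and> set is \<subseteq> {1..n}"

definition commutation_rels :: "nat \<Rightarrow> (nat set word \<times> nat set word) set" where
  "commutation_rels n =
     {([letter i j, letter k l], [letter k l, letter i j]) | i j k l. distinct_indices n [i, j, k, l]}"

definition involution_rels :: "nat \<Rightarrow> (nat set word \<times> nat set word) set" where
  "involution_rels n = {([letter i j, letter i j], []) | i j. distinct_indices n [i, j]}"

definition G2_rels :: "nat \<Rightarrow> (nat set word \<times> nat set word) set" where
  "G2_rels n =
     {([letter i j, letter i k, letter j k], [letter j k, letter i k, letter i j]) | i j k.
        distinct_indices n [i, j, k]}
     \<union> commutation_rels n \<union> involution_rels n"

definition C2_rels :: "nat \<Rightarrow> (nat set word \<times> nat set word) set" where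
  "C2_rels n =
     {(concat (replicate 3 [letter i j, letter i k]), []) | i j k. distinct_indices n [i, j, k]}
     \<union> commutation_rels n \<union> involution_rels n"

definition G2 :: "nat \<Rightarrow> nat set word set monoid" where
  "G2 n = presented_group (index_pairs n) (G2_rels n)"

definition C2 :: "nat \<Rightarrow> nat set word set monoid" where
  "C2 n = presented_group (index_pairs n) (C2_rels n)"

definition gen_a :: "nat \<Rightarrow> nat \<Rightarrow> nat \<Rightarrow> nat set word set" where
  "gen_a n i j = presented_gen (index_pairs n) (G2_rels n) {i, j}"

definition gen_b :: "nat \<Rightarrow> nat \<Rightarrow> nat \<Rightarrow> nat set word set" where
  "gen_b n i j = presented_gen (index_pairs n) (C2_rels n) {i, j}"

text \<open>The image \<open>\<sigma> ` {i, j}\<close> is \<open>{\<sigma> i, \<sigma> j}\<close>.\<close>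

definition G2_action :: "nat \<Rightarrow> (nat \<Rightarrow> nat) \<Rightarrow> nat set word set \<Rightarrow> nat set word set" where
  "G2_action n \<sigma> = relabel (index_pairs n) (G2_rels n) ((`) \<sigma>)"

definition C2_action :: "nat \<Rightarrow> (nat \<Rightarrow> nat) \<Rightarrow> nat set word set \<Rightarrow> nat set word set" where
  "C2_action n \<sigma> = relabel (index_pairs n) (C2_rels n) ((`) \<sigma>)"

definition G2_semidirect :: "nat \<Rightarrow> (nat set word set \<times> (nat \<Rightarrow> nat)) monoid" where
  "G2_semidirect n = semidirect (G2 n) (sym_group n) (G2_action n)"

definition C2_semidirect :: "nat \<Rightarrow> (nat set word set \<times> (nat \<Rightarrow> nat)) monoid" where
  "C2_semidirect n = semidirect (C2 n) (sym_group n) (C2_action n)"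

lemma relabel_word_letter [simp]:
  "relabel_word ((`) \<sigma>) (letter i j # w) = letter (\<sigma> i) (\<sigma> j) # relabel_word ((`) \<sigma>) w"
  by (simp add: letter_def)

lemma index_pairs_image: "\<sigma> permutes {1..n} \<Longrightarrow> (`) \<sigma> ` index_pairs n \<subseteq> index_pairs n"
proof
  fix e assume \<sigma>: "\<sigma> permutes {1..n}" and "e \<in> (`) \<sigma> ` index_pairs n"
  then obtain i j where "e = {\<sigma> i, \<sigma> j}" "i \<in> {1..n}" "j \<in> {1..n}" "i \<noteq> j"
    by (auto simp: index_pairs_def)
  moreover have "\<sigma> i \<in> {1..n}" "\<sigma> j \<in> {1..n}" "\<sigma> i \<noteq> \<sigma> j"
    using calculation permutes_in_image[OF \<sigma>] permutes_inj[OF \<sigma>] by (auto simp: inj_def)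
  ultimately show "e \<in> index_pairs n" unfolding index_pairs_def by blast
qed

lemma distinct_indices_map:
  "\<sigma> permutes {1..n} \<Longrightarrow> distinct_indices n is \<Longrightarrow> distinct_indices n (map \<sigma> is)"
  using permutes_in_image[of \<sigma> "{1..n}"] permutes_inj_on[of \<sigma> "{1..n}" "set is"]
  by (auto simp: distinct_indices_def distinct_map)

lemma commutation_rels_relabel:
  assumes "\<sigma> permutes {1..n}" "(u, v) \<in> commutation_rels n"
  shows "(relabel_word ((`) \<sigma>) u, relabel_word ((`) \<sigma>) v) \<in> commutation_rels n"
proof -
  obtain i j k l where "distinct_indices n [i, j, k, l]"
    "u = [letter i j, letter k l]" "v = [letter k l, letter i j]"
    using assms(2) by (auto simp: commutation_rels_def)
  with distinct_indices_map[OF assms(1) this(1)] show ?thesis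
    unfolding commutation_rels_def by (auto intro!: exI)
qed

lemma involution_rels_relabel:
  assumes "\<sigma> permutes {1..n}" "(u, v) \<in> involution_rels n"
  shows "(relabel_word ((`) \<sigma>) u, relabel_word ((`) \<sigma>) v) \<in> involution_rels n"
proof -
  obtain i j where "distinct_indices n [i, j]" "u = [letter i j, letter i j]" "v = []"
    using assms(2) by (auto simp: involution_rels_def)
  with distinct_indices_map[OF assms(1) this(1)] show ?thesis
    unfolding involution_rels_def by (auto intro!: exI)
qed

lemma G2_rels_relabel:
  assumes "\<sigma> permutes {1..n}" "(u, v) \<in> G2_rels n"
  shows "(relabel_word ((`) \<sigma>) u, relabel_word ((`) \<sigma>) v) \<in> G2_rels n"
proof (cases "(u, v) \<in> commutation_rels n \<union> involution_rels n")
  case True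
  then show ?thesis
    using commutation_rels_relabel[OF assms(1)] involution_rels_relabel[OF assms(1)]
    by (auto simp: G2_rels_def)
next
  case False
  then obtain i j k where "distinct_indices n [i, j, k]"
    "u = [letter i j, letter i k, letter j k]" "v = [letter j k, letter i k, letter i j]"
    using assms(2) by (auto simp: G2_rels_def)
  with distinct_indices_map[OF assms(1) this(1)] show ?thesis
    unfolding G2_rels_def by (auto intro!: exI)
qed

lemma C2_rels_relabel:
  assumes "\<sigma> permutes {1..n}" "(u, v) \<in> C2_rels n"
  shows "(relabel_word ((`) \<sigma>) u, relabel_word ((`) \<sigma>) v) \<in> C2_rels n"
proof (cases "(u, v) \<in> commutation_rels n \<union> involution_rels n")
  case True
  then show ?thesis
    using commutation_rels_relabel[OF assms(1)] involution_rels_relabel[OF assms(1)]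
    by (auto simp: C2_rels_def)
next
  case False
  then obtain i j k where "distinct_indices n [i, j, k]"
    "u = concat (replicate 3 [letter i j, letter i k])" "v = []"
    using assms(2) by (auto simp: C2_rels_def)
  with distinct_indices_map[OF assms(1) this(1)] show ?thesis
    unfolding C2_rels_def by (auto simp: numeral_3_eq_3 intro!: exI)
qed

context
  fixes n :: nat and R :: "(nat set word \<times> nat set word) set"
  assumes R: "\<And>\<sigma> u v. \<sigma> permutes {1..n} \<Longrightarrow> (u, v) \<in> R \<Longrightarrow>
    (relabel_word ((`) \<sigma>) u, relabel_word ((`) \<sigma>) v) \<in> R"
begin

lemma relabel_word_class_permutes:
  assumes \<sigma>: "\<sigma> permutes {1..n}" and w: "w \<in> words (index_pairs n)"
  shows "relabel (index_pairs n) R ((`) \<sigma>) (word_class (index_pairs n) R w) =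
    word_class (index_pairs n) R (relabel_word ((`) \<sigma>) w)"
proof (rule relabel_word_class[where f' = "(`) (inv_into UNIV \<sigma>)"])
  have inv: "inv_into UNIV \<sigma> permutes {1..n}" using \<sigma> by (rule permutes_inv)
  show "(`) \<sigma> \<circ> (`) (inv_into UNIV \<sigma>) = id" "(`) (inv_into UNIV \<sigma>) \<circ> (`) \<sigma> = id"
    using permutes_inv_o[OF \<sigma>] by (auto simp: fun_eq_iff image_comp)
  show "(`) \<sigma> ` index_pairs n \<subseteq> index_pairs n"
    "(`) (inv_into UNIV \<sigma>) ` index_pairs n \<subseteq> index_pairs n"
    using index_pairs_image \<sigma> inv by blast+
qed (use R \<sigma> w permutes_inv in blast)+

lemma relabel_permutes_hom:
  "(\<lambda>\<sigma>. relabel (index_pairs n) R ((`) \<sigma>))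
     \<in> hom (sym_group n) (AutoGroup (presented_group (index_pairs n) R))"
proof -
  let ?P = "presented_group (index_pairs n) R"
  let ?\<phi> = "\<lambda>\<sigma>. relabel (index_pairs n) R ((`) \<sigma>)"
  have words: "relabel_word ((`) \<sigma>) w \<in> words (index_pairs n)"
    if "\<sigma> permutes {1..n}" "w \<in> words (index_pairs n)" for \<sigma> w
    using that by (intro relabel_word_words index_pairs_image)
  have hom: "?\<phi> \<sigma> \<in> hom ?P ?P" if "\<sigma> permutes {1..n}" for \<sigma>
    using that
    by (intro homI)
      (auto simp: presented_group_carrier presented_group_mult relabel_word_class_permutes words)
  have comp: "?\<phi> (\<sigma> \<circ> \<tau>) X = ?\<phi> \<sigma> (?\<phi> \<tau> X)"
    if "\<sigma> permutes {1..n}" "\<tau> permutes {1..n}" "X \<in> carrier ?P" for \<sigma> \<tau> X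
  proof -
    obtain w where w: "w \<in> words (index_pairs n)" "X = word_class (index_pairs n) R w"
      using \<open>X \<in> carrier ?P\<close> by (auto simp: presented_group_carrier)
    have "relabel_word ((`) (\<sigma> \<circ> \<tau>)) w = relabel_word ((`) \<sigma>) (relabel_word ((`) \<tau>) w)"
      by (auto simp: relabel_word_def image_comp)
    then show ?thesis
      using w that permutes_compose[of \<tau> "{1..n}" \<sigma>]
      by (simp add: relabel_word_class_permutes words)
  qed
  have id: "?\<phi> id X = X" if "X \<in> carrier ?P" for X
    using that by (simp add: relabel_def relabel_word_def prod.map_id0)
  have bij: "?\<phi> \<sigma> \<in> Bij (carrier ?P)" if \<sigma>: "\<sigma> permutes {1..n}" for \<sigma>
  proof -
    have inv: "inv_into UNIV \<sigma> permutes {1..n}" using \<sigma> by (rule permutes_inv)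
    have "bij_betw (?\<phi> \<sigma>) (carrier ?P) (carrier ?P)"
    proof (rule bij_betw_byWitness[where f' = "?\<phi> (inv_into UNIV \<sigma>)"])
      show "\<forall>X\<in>carrier ?P. ?\<phi> (inv_into UNIV \<sigma>) (?\<phi> \<sigma> X) = X"
        using comp[OF inv \<sigma>] id by (simp add: permutes_inv_o[OF \<sigma>])
      show "\<forall>X\<in>carrier ?P. ?\<phi> \<sigma> (?\<phi> (inv_into UNIV \<sigma>) X) = X"
        using comp[OF \<sigma> inv] id by (simp add: permutes_inv_o[OF \<sigma>])
    qed (rule hom_carrier[OF hom[OF \<sigma>]], rule hom_carrier[OF hom[OF inv]])
    then show ?thesis by (simp add: Bij_def relabel_def)
  qed
  show ?thesis
  proof (rule homI)
    fix \<sigma> \<tau> assume "\<sigma> \<in> carrier (sym_group n)" "\<tau> \<in> carrier (sym_group n)"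
    then have p: "\<sigma> permutes {1..n}" "\<tau> permutes {1..n}" by (auto simp: sym_group_carrier)
    have "?\<phi> (\<sigma> \<circ> \<tau>) = compose (carrier ?P) (?\<phi> \<sigma>) (?\<phi> \<tau>)"
      using comp[OF p]
      by (intro extensionalityI[where A = "carrier ?P"]) (auto simp: relabel_def compose_def)
    then show "?\<phi> (\<sigma> \<otimes>\<^bsub>sym_group n\<^esub> \<tau>) = ?\<phi> \<sigma> \<otimes>\<^bsub>AutoGroup ?P\<^esub> ?\<phi> \<tau>"
      using bij[OF p(1)] bij[OF p(2)] by (simp add: sym_group_mult AutoGroup_def BijGroup_def)
  qed (use hom bij in \<open>auto simp: AutoGroup_def auto_def sym_group_carrier\<close>)
qed

end

lemma G2_action_hom: "G2_action n \<in> hom (sym_group n) (AutoGroup (G2 n))"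
  using relabel_permutes_hom[OF G2_rels_relabel] by (simp add: G2_action_def[abs_def] G2_def)

lemma C2_action_hom: "C2_action n \<in> hom (sym_group n) (AutoGroup (C2 n))"
  using relabel_permutes_hom[OF C2_rels_relabel] by (simp add: C2_action_def[abs_def] C2_def)

lemma index_pairsI: "i \<in> {1..n} \<Longrightarrow> j \<in> {1..n} \<Longrightarrow> i \<noteq> j \<Longrightarrow> {i, j} \<in> index_pairs n"
  by (auto simp: index_pairs_def)

lemma G2_action_gen_a:
  assumes "\<sigma> permutes {1..n}" "i \<in> {1..n}" "j \<in> {1..n}" "i \<noteq> j"
  shows "G2_action n \<sigma> (gen_a n i j) = gen_a n (\<sigma> i) (\<sigma> j)"
  using assms relabel_word_class_permutes[OF G2_rels_relabel assms(1), where w = "[({i, j}, True)]"]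
  by (simp add: G2_action_def gen_a_def presented_gen_def index_pairsI)

lemma C2_action_gen_b:
  assumes "\<sigma> permutes {1..n}" "i \<in> {1..n}" "j \<in> {1..n}" "i \<noteq> j"
  shows "C2_action n \<sigma> (gen_b n i j) = gen_b n (\<sigma> i) (\<sigma> j)"
  using assms relabel_word_class_permutes[OF C2_rels_relabel assms(1), where w = "[({i, j}, True)]"]
  by (simp add: C2_action_def gen_b_def presented_gen_def index_pairsI)

lemma group_G2: "group (G2 n)"
  and group_C2: "group (C2 n)"
  by (simp_all add: G2_def C2_def group_presented_group)

lemma group_G2_semidirect: "group (G2_semidirect n)"
  unfolding G2_semidirect_def
  by (intro group_semidirect group_G2 sym_group_is_group G2_action_hom)

lemma group_C2_semidirect: "group (C2_semidirect n)"
  unfolding C2_semidirect_def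
  by (intro group_semidirect group_C2 sym_group_is_group C2_action_hom)

lemma G2_embedding: "(\<lambda>g. (g, id)) \<in> mon (G2 n) (G2_semidirect n)"
  using AutoGroup_hom_facts(4)[OF group_G2 sym_group_is_group G2_action_hom]
  by (auto simp: mon_def hom_def inj_on_def G2_semidirect_def sym_group_mult sym_group_one
      sym_group_carrier permutes_id)

end

theory Submission
  imports Defs
begin

text \<open>Both groups carry the action of the symmetric group, and the same recipe
  \<open>e \<mapsto> (e, swap of e)\<close> is used in both directions. Multiplying such pairs in the semidirect product
  moves every swap past all later letters, so a word \<open>e\<^sub>1 e\<^sub>2 \<dots>\<close> goes to the pair of its
  \<^emph>\<open>twist\<close>, in which the \<open>k\<close>-th letter has been relabelled by the product of the first \<open>k - 1\<close> swaps,
  and of the product of all swaps (\<open>word_eval_twisted_gen\<close>).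
  Hence the recipe defines a homomorphism as soon as the twists of the two sides of every relation
  are congruent and their swaps have the same product (\<open>twisted_hom\<close>).

  Twisting exchanges the two kinds of relations on three indices. With \<open>x, y, z\<close> the letters
  \<open>ij, jk, ik\<close>, the word \<open>(ij ik)\<^sup>3\<close> becomes \<open>(x y z)\<^sup>2\<close>, which is trivial in \<open>G\<^sub>n\<^sup>2\<close> because
  there \<open>x y z = z y x\<close> and letters are involutions; and the two sides \<open>ij ik jk\<close> and \<open>jk ik ij\<close> become
  the two sides of the braid relation \<open>x y x = y x y\<close>, which for involutions
  \<open>x, y\<close> is equivalent to the relation \<open>(x y)\<^sup>3 = 1\<close> of \<open>C(n,2)\<close>. The relations on two and four indices are left unchanged, as a swap fixes its own
  letter and every letter disjoint from it.

  The two homomorphisms obtained are mutually inverse: both composites fix every \<open>(1, \<sigma>)\<close>, and they fix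
  the generators since \<open>(e, swap)(1, swap) = (e, 1)\<close>. The subgroup \<open>G\<^sub>n\<^sup>2 \<times> {1}\<close> is the kernel of
  the projection to the symmetric group, so its preimage is a kernel as well.\<close>

\<comment> \<open>Keeps the index set in the form \<open>{1..n}\<close>, in which the facts about permutations are stated.\<close>
declare One_nat_def [simp del]


section \<open>Homomorphisms out of a semidirect product\<close>

text \<open>The compatibility condition says that conjugation by \<open>k s\<close> realises the action of \<open>s\<close>; it is
  what lets \<open>k s\<close> be moved to the right past \<open>f g\<close>.\<close>

lemma semidirect_hom:
  assumes "group G" "group H" "group L" "\<phi> \<in> hom H (AutoGroup G)"
    and f: "f \<in> hom G L" and k: "k \<in> hom H L"
    and compat: "\<And>s g. s \<in> carrier H \<Longrightarrow> g \<in> carrier G \<Longrightarrow> k s \<otimes>\<^bsub>L\<^esub> f g = f (\<phi> s g) \<otimes>\<^bsub>L\<^esub> k s"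
  shows "(\<lambda>(g, s). f g \<otimes>\<^bsub>L\<^esub> k s) \<in> hom (semidirect G H \<phi>) L"
proof (rule homI)
  interpret L: group L by fact
  note \<phi> = AutoGroup_hom_facts[OF assms(1,2,4)]
  note closed = hom_in_carrier[OF f] hom_in_carrier[OF k]
  fix x assume "x \<in> carrier (semidirect G H \<phi>)"
  then show "(case x of (g, s) \<Rightarrow> f g \<otimes>\<^bsub>L\<^esub> k s) \<in> carrier L"
    by (auto simp: closed)
  fix y assume "y \<in> carrier (semidirect G H \<phi>)"
  with \<open>x \<in> _\<close> obtain g s h t where xy: "x = (g, s)" "y = (h, t)"
    and in_G: "g \<in> carrier G" "h \<in> carrier G" and in_H: "s \<in> carrier H" "t \<in> carrier H"
    by auto
  have "f (g \<otimes>\<^bsub>G\<^esub> \<phi> s h) \<otimes>\<^bsub>L\<^esub> k (s \<otimes>\<^bsub>H\<^esub> t) = f g \<otimes>\<^bsub>L\<^esub> (f (\<phi> s h) \<otimes>\<^bsub>L\<^esub> k s) \<otimes>\<^bsub>L\<^esub> k t"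
    using in_G in_H \<phi>(2) by (simp add: hom_mult[OF f] hom_mult[OF k] closed L.m_assoc)
  also have "\<dots> = f g \<otimes>\<^bsub>L\<^esub> (k s \<otimes>\<^bsub>L\<^esub> f h) \<otimes>\<^bsub>L\<^esub> k t"
    using in_G in_H by (simp add: compat)
  also have "\<dots> = (f g \<otimes>\<^bsub>L\<^esub> k s) \<otimes>\<^bsub>L\<^esub> (f h \<otimes>\<^bsub>L\<^esub> k t)"
    using in_G in_H by (simp add: closed L.m_assoc)
  finally show "(case x \<otimes>\<^bsub>semidirect G H \<phi>\<^esub> y of (g, s) \<Rightarrow> f g \<otimes>\<^bsub>L\<^esub> k s) =
      (case x of (g, s) \<Rightarrow> f g \<otimes>\<^bsub>L\<^esub> k s) \<otimes>\<^bsub>L\<^esub> (case y of (g, s) \<Rightarrow> f g \<otimes>\<^bsub>L\<^esub> k s)"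
    by (simp add: xy)
qed

lemma (in group) conj_hom: "x \<in> carrier G \<Longrightarrow> (\<lambda>g. x \<otimes> g \<otimes> inv x) \<in> hom G G"
  by (rule homI) (simp_all add: m_assoc inv_solve_left)

text \<open>Both \<open>X \<mapsto> x (f X) x\<^sup>-\<^sup>1\<close> and \<open>X \<mapsto> f (p X)\<close> are homomorphisms, so it suffices to compare
  them on generators.\<close>

lemma presented_group_hom_conj_equivariant:
  assumes "group L" and f: "f \<in> hom (presented_group S R) L"
    and p: "p \<in> hom (presented_group S R) (presented_group S R)" and x: "x \<in> carrier L"
    and gens: "\<And>g. g \<in> S \<Longrightarrow>
      x \<otimes>\<^bsub>L\<^esub> f (presented_gen S R g) = f (p (presented_gen S R g)) \<otimes>\<^bsub>L\<^esub> x"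
    and X: "X \<in> carrier (presented_group S R)"
  shows "x \<otimes>\<^bsub>L\<^esub> f X = f (p X) \<otimes>\<^bsub>L\<^esub> x"
proof -
  interpret L: group L by fact
  note closed = hom_in_carrier[OF f] hom_in_carrier[OF p]
  have "((\<lambda>g. x \<otimes>\<^bsub>L\<^esub> g \<otimes>\<^bsub>L\<^esub> inv\<^bsub>L\<^esub> x) \<circ> f) X = (f \<circ> p) X"
  proof (rule presented_group_hom_unique[OF \<open>group L\<close> _ _ _ X])
    show "(\<lambda>g. x \<otimes>\<^bsub>L\<^esub> g \<otimes>\<^bsub>L\<^esub> inv\<^bsub>L\<^esub> x) \<circ> f \<in> hom (presented_group S R) L"
      using f L.conj_hom[OF x] by (rule hom_compose)
    show "f \<circ> p \<in> hom (presented_group S R) L"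
      using p f by (rule hom_compose)
    fix g assume "g \<in> S"
    then show "((\<lambda>g. x \<otimes>\<^bsub>L\<^esub> g \<otimes>\<^bsub>L\<^esub> inv\<^bsub>L\<^esub> x) \<circ> f) (presented_gen S R g) = (f \<circ> p) (presented_gen S R g)"
      using gens[of g] x by (simp add: presented_gen_carrier closed L.m_assoc)
  qed
  then show ?thesis using X x by (simp add: closed L.inv_solve_right')
qed


section \<open>Letters as transpositions\<close>

text \<open>Minimum and maximum serve only to recover the two indices from an unordered pair.\<close>

definition pair_swap :: "nat set \<Rightarrow> nat \<Rightarrow> nat" where
  "pair_swap e = transpose (Min e) (Max e)"

lemma pair_swap_doubleton [simp]: "pair_swap {i, j} = transpose i j"
  by (cases "i \<le> j") (simp_all add: pair_swap_def min_def max_def transpose_commute)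

lemma pair_swap_permutes: "e \<in> index_pairs n \<Longrightarrow> pair_swap e permutes {1..n}"
  unfolding index_pairs_def using permutes_swap_id[of _ "{1..n}"] by force

lemma pair_swap_fixes_pair: "e \<in> index_pairs n \<Longrightarrow> pair_swap e ` e = e"
  by (auto simp: index_pairs_def)

lemma pair_swap_involutory: "e \<in> index_pairs n \<Longrightarrow> pair_swap e \<circ> pair_swap e = id"
  by (auto simp: index_pairs_def)

lemma pair_swap_conj:
  assumes "\<sigma> permutes {1..n}" "e \<in> index_pairs n"
  shows "pair_swap (\<sigma> ` e) \<circ> \<sigma> = \<sigma> \<circ> pair_swap e"
  using assms(2) permutes_inj[OF assms(1)]
  by (auto simp: index_pairs_def fun_eq_iff transpose_def inj_eq)

text \<open>The twist of a word is the first component, and the product of swaps the second component,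
  of the product of the pairs \<open>(e, pair_swap e)\<close> over the letters of the word.\<close>

fun twist :: "nat set word \<Rightarrow> nat set word" where
  "twist [] = []"
| "twist ((e, b) # w) = (e, b) # relabel_word ((`) (pair_swap e)) (twist w)"

fun swap_product :: "nat set word \<Rightarrow> nat \<Rightarrow> nat" where
  "swap_product [] = id"
| "swap_product ((e, b) # w) = pair_swap e \<circ> swap_product w"

lemma letter_commute: "letter j i = letter i j"
  by (simp add: letter_def insert_commute)

lemma twist_letter [simp]:
  "twist (letter i j # w) = letter i j # relabel_word ((`) (transpose i j)) (twist w)"
  by (simp add: letter_def)

lemma swap_product_letter [simp]:
  "swap_product (letter i j # w) = transpose i j \<circ> swap_product w"
  by (simp add: letter_def)

lemma twist_words: "w \<in> words (index_pairs n) \<Longrightarrow> twist w \<in> words (index_pairs n)"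
  by (induction w rule: twist.induct)
    (simp_all add: relabel_word_words index_pairs_image[OF pair_swap_permutes])


section \<open>The twisted homomorphism\<close>

locale symmetric_presentation =
  fixes n :: nat and R :: "(nat set word \<times> nat set word) set"
  assumes relabel_closed: "\<And>\<sigma> u v. \<sigma> permutes {1..n} \<Longrightarrow> (u, v) \<in> R \<Longrightarrow>
    (relabel_word ((`) \<sigma>) u, relabel_word ((`) \<sigma>) v) \<in> R"
begin

abbreviation "P \<equiv> presented_group (index_pairs n) R"
abbreviation "cls \<equiv> word_class (index_pairs n) R"
abbreviation "gen \<equiv> presented_gen (index_pairs n) R"
abbreviation "act \<equiv> \<lambda>\<sigma>. relabel (index_pairs n) R ((`) \<sigma>)"

definition sdp :: "(nat set word set \<times> (nat \<Rightarrow> nat)) monoid" where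
  "sdp = semidirect P (sym_group n) act"

definition twisted_gen :: "nat set \<Rightarrow> nat set word set \<times> (nat \<Rightarrow> nat)" where
  "twisted_gen e = (gen e, pair_swap e)"

lemma act_hom: "act \<in> hom (sym_group n) (AutoGroup P)"
  using relabel_closed by (rule relabel_permutes_hom)

lemma act_class:
  assumes "\<sigma> permutes {1..n}" "w \<in> words (index_pairs n)"
  shows "act \<sigma> (cls w) = cls (relabel_word ((`) \<sigma>) w)"
  using relabel_closed assms by (rule relabel_word_class_permutes)

lemmas act_facts = AutoGroup_hom_facts[OF group_presented_group sym_group_is_group act_hom]

lemma act_one: "\<sigma> permutes {1..n} \<Longrightarrow> act \<sigma> \<one>\<^bsub>P\<^esub> = \<one>\<^bsub>P\<^esub>"
  by (simp add: presented_group_one act_class)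

lemma act_gen: "\<sigma> permutes {1..n} \<Longrightarrow> e \<in> index_pairs n \<Longrightarrow> act \<sigma> (gen e) = gen (\<sigma> ` e)"
  by (simp add: presented_gen_def act_class)

lemma group_sdp: "group sdp"
  unfolding sdp_def by (rule group_semidirect[OF group_presented_group sym_group_is_group act_hom])

lemma carrier_sdp: "carrier sdp = carrier P \<times> {\<sigma>. \<sigma> permutes {1..n}}"
  by (auto simp: sdp_def sym_group_carrier)

lemma mult_sdp: "(X, \<sigma>) \<otimes>\<^bsub>sdp\<^esub> (Y, \<tau>) = (X \<otimes>\<^bsub>P\<^esub> act \<sigma> Y, \<sigma> \<circ> \<tau>)"
  by (simp add: sdp_def sym_group_mult)

lemma one_sdp: "\<one>\<^bsub>sdp\<^esub> = (\<one>\<^bsub>P\<^esub>, id)"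
  by (simp add: sdp_def sym_group_one)

lemma twisted_gen_closed: "e \<in> index_pairs n \<Longrightarrow> twisted_gen e \<in> carrier sdp"
  by (simp add: twisted_gen_def carrier_sdp presented_gen_carrier pair_swap_permutes)

lemma mult_class_sdp:
  assumes "\<sigma> permutes {1..n}" "u \<in> words (index_pairs n)" "v \<in> words (index_pairs n)"
  shows "(cls u, \<sigma>) \<otimes>\<^bsub>sdp\<^esub> (cls v, \<tau>) = (cls (u @ relabel_word ((`) \<sigma>) v), \<sigma> \<circ> \<tau>)"
  using assms index_pairs_image[OF assms(1)]
  by (simp add: mult_sdp act_class presented_group_mult relabel_word_words)

text \<open>The formal inverse is treated like the letter itself because the swap is an involution that
  fixes its own letter.\<close>

lemma inv_twisted_gen:
  assumes "e \<in> index_pairs n"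
  shows "inv\<^bsub>sdp\<^esub> twisted_gen e = (cls [(e, False)], pair_swap e)"
proof -
  interpret sdp: group sdp by (rule group_sdp)
  have "word_cong (index_pairs n) R [(e, False), (e, True)] []"
    using word_cong.cancel[of e "index_pairs n" R False] assms by simp
  then have "(cls [(e, False)], pair_swap e) \<otimes>\<^bsub>sdp\<^esub> twisted_gen e = \<one>\<^bsub>sdp\<^esub>"
    using assms
    by (simp add: twisted_gen_def presented_gen_def mult_class_sdp pair_swap_permutes
        pair_swap_fixes_pair pair_swap_involutory one_sdp presented_group_one word_class_eq_iff)
  then show ?thesis
    using assms by (intro sdp.inv_equality)
      (simp_all add: twisted_gen_closed, simp add: carrier_sdp presented_group_carrier pair_swap_permutes)
qed

text \<open>This turns identities between products in the semidirect product into congruences of words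
  and identities of permutations.\<close>

lemma word_eval_twisted_gen:
  "w \<in> words (index_pairs n) \<Longrightarrow> word_eval sdp twisted_gen w = (cls (twist w), swap_product w)"
proof (induction w rule: twist.induct)
  case 1
  then show ?case by (simp add: word_eval_def one_sdp presented_group_one fun_eq_iff)
next
  case (2 e b w)
  have "(if b then twisted_gen e else inv\<^bsub>sdp\<^esub> twisted_gen e) = (cls [(e, b)], pair_swap e)"
    using 2 by (cases b) (simp_all add: inv_twisted_gen, simp add: twisted_gen_def presented_gen_def)
  then have "word_eval sdp twisted_gen ((e, b) # w) =
      (cls [(e, b)], pair_swap e) \<otimes>\<^bsub>sdp\<^esub> (cls (twist w), swap_product w)"
    using 2 by (simp add: word_eval_def)
  then show ?case
    using 2 by (simp add: mult_class_sdp pair_swap_permutes twist_words fun_eq_iff)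
qed

text \<open>A permutation renames the letter by acting on the first component and its transposition by
  conjugating the second, consistently. This equivariance lets the homomorphism extend from the
  presented group to the semidirect product.\<close>

lemma conj_twisted_gen:
  assumes "\<sigma> permutes {1..n}" "e \<in> index_pairs n"
  shows "(\<one>\<^bsub>P\<^esub>, \<sigma>) \<otimes>\<^bsub>sdp\<^esub> twisted_gen e = twisted_gen (\<sigma> ` e) \<otimes>\<^bsub>sdp\<^esub> (\<one>\<^bsub>P\<^esub>, \<sigma>)"
proof -
  interpret P: group P by (rule group_presented_group)
  have "\<sigma> ` e \<in> index_pairs n" using index_pairs_image[OF assms(1)] assms(2) by blast
  then show ?thesis
    using assms
    by (simp add: twisted_gen_def mult_sdp act_gen act_one pair_swap_conj pair_swap_permutes
        presented_gen_carrier)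
qed

lemma perm_embedding_hom: "(\<lambda>\<sigma>. (\<one>\<^bsub>P\<^esub>, \<sigma>)) \<in> hom (sym_group n) sdp"
proof -
  interpret P: group P by (rule group_presented_group)
  show ?thesis
    by (rule homI) (simp_all add: carrier_sdp mult_sdp sym_group_carrier sym_group_mult act_one)
qed

lemma group_embedding_hom: "(\<lambda>X. (X, id)) \<in> hom P sdp"
  using act_facts(4) by (auto intro!: homI simp: carrier_sdp mult_sdp sym_group_one permutes_id)

lemma sdp_factor:
  assumes "X \<in> carrier P" "\<sigma> permutes {1..n}"
  shows "(X, id) \<otimes>\<^bsub>sdp\<^esub> (\<one>\<^bsub>P\<^esub>, \<sigma>) = (X, \<sigma>)"
proof -
  interpret P: group P by (rule group_presented_group)
  show ?thesis using assms act_one[OF permutes_id] by (simp add: mult_sdp)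
qed

lemma sdp_hom_unique:
  assumes "group L" "h \<in> hom sdp L" "k \<in> hom sdp L"
    and gens: "\<And>e. e \<in> index_pairs n \<Longrightarrow> h (gen e, id) = k (gen e, id)"
    and perms: "\<And>\<sigma>. \<sigma> permutes {1..n} \<Longrightarrow> h (\<one>\<^bsub>P\<^esub>, \<sigma>) = k (\<one>\<^bsub>P\<^esub>, \<sigma>)"
    and "x \<in> carrier sdp"
  shows "h x = k x"
proof -
  interpret P: group P by (rule group_presented_group)
  obtain X \<sigma> where x: "x = (X, \<sigma>)" and X: "X \<in> carrier P" and \<sigma>: "\<sigma> permutes {1..n}"
    using assms(6) by (auto simp: carrier_sdp)
  have "(h \<circ> (\<lambda>X. (X, id))) X = (k \<circ> (\<lambda>X. (X, id))) X"
  proof (rule presented_group_hom_unique[OF assms(1) _ _ _ X])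
    show "h \<circ> (\<lambda>X. (X, id)) \<in> hom P L"
      using group_embedding_hom assms(2) by (rule hom_compose)
    show "k \<circ> (\<lambda>X. (X, id)) \<in> hom P L"
      using group_embedding_hom assms(3) by (rule hom_compose)
  qed (unfold comp_apply, rule gens)
  moreover have "(X, id) \<in> carrier sdp" "(\<one>\<^bsub>P\<^esub>, \<sigma>) \<in> carrier sdp"
    using X \<sigma> by (simp_all add: carrier_sdp permutes_id)
  ultimately have "h ((X, id) \<otimes>\<^bsub>sdp\<^esub> (\<one>\<^bsub>P\<^esub>, \<sigma>)) = k ((X, id) \<otimes>\<^bsub>sdp\<^esub> (\<one>\<^bsub>P\<^esub>, \<sigma>))"
    using perms[OF \<sigma>] by (simp add: hom_mult[OF assms(2)] hom_mult[OF assms(3)])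
  then show ?thesis by (simp add: x sdp_factor X \<sigma>)
qed

end

locale twisted_presentations =
  source: symmetric_presentation n R + target: symmetric_presentation n R'
  for n :: nat and R R' :: "(nat set word \<times> nat set word) set" +
  assumes twist_cong: "\<And>u v. (u, v) \<in> R \<Longrightarrow> word_cong (index_pairs n) R' (twist u) (twist v)"
    and swap_product_eq: "\<And>u v. (u, v) \<in> R \<Longrightarrow> swap_product u = swap_product v"
begin

text \<open>The universal property of the presentation gives \<open>f\<close> on the first factor; it extends to the
  semidirect product because its values on generators are equivariant under conjugation.\<close>

lemma twisted_hom:
  "\<exists>h\<in>hom source.sdp target.sdp.
     (\<forall>e\<in>index_pairs n. h (source.gen e, id) = target.twisted_gen e) \<and>
     (\<forall>\<sigma>. \<sigma> permutes {1..n} \<longrightarrow> h (\<one>\<^bsub>source.P\<^esub>, \<sigma>) = (\<one>\<^bsub>target.P\<^esub>, \<sigma>))"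
proof -
  interpret L: group target.sdp by (rule target.group_sdp)
  let ?k = "\<lambda>\<sigma>. (\<one>\<^bsub>target.P\<^esub>, \<sigma> :: nat \<Rightarrow> nat)"
  have "\<exists>f\<in>hom source.P target.sdp. \<forall>e\<in>index_pairs n. f (source.gen e) = target.twisted_gen e"
  proof (rule presented_group_universal[OF target.group_sdp])
    show "target.twisted_gen \<in> index_pairs n \<rightarrow> carrier target.sdp"
      using target.twisted_gen_closed by blast
    fix u v assume "(u, v) \<in> R" "u \<in> words (index_pairs n)" "v \<in> words (index_pairs n)"
    then show "word_eval target.sdp target.twisted_gen u = word_eval target.sdp target.twisted_gen v"
      using twist_cong swap_product_eq
      by (simp add: target.word_eval_twisted_gen word_class_eq_iff twist_words)
  qed
  then obtain f where f: "f \<in> hom source.P target.sdp"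
    and f_gen: "\<And>e. e \<in> index_pairs n \<Longrightarrow> f (source.gen e) = target.twisted_gen e"
    by blast
  have compat: "?k \<sigma> \<otimes>\<^bsub>target.sdp\<^esub> f X = f (source.act \<sigma> X) \<otimes>\<^bsub>target.sdp\<^esub> ?k \<sigma>"
    if "\<sigma> \<in> carrier (sym_group n)" "X \<in> carrier source.P" for \<sigma> X
  proof (rule presented_group_hom_conj_equivariant[OF target.group_sdp f _ _ _ that(2)])
    have \<sigma>: "\<sigma> permutes {1..n}" using that(1) by (simp add: sym_group_carrier)
    show "source.act \<sigma> \<in> hom source.P source.P"
      using source.act_facts(1) that(1) .
    show "?k \<sigma> \<in> carrier target.sdp"
      using hom_in_carrier[OF target.perm_embedding_hom that(1)] .
    fix e assume e: "e \<in> index_pairs n"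
    then have "\<sigma> ` e \<in> index_pairs n" using index_pairs_image[OF \<sigma>] by blast
    with \<sigma> e show "?k \<sigma> \<otimes>\<^bsub>target.sdp\<^esub> f (source.gen e) =
        f (source.act \<sigma> (source.gen e)) \<otimes>\<^bsub>target.sdp\<^esub> ?k \<sigma>"
      by (simp add: f_gen source.act_gen target.conj_twisted_gen)
  qed
  show ?thesis
  proof (intro bexI conjI)
    show "(\<lambda>(X, \<sigma>). f X \<otimes>\<^bsub>target.sdp\<^esub> ?k \<sigma>) \<in> hom source.sdp target.sdp"
      unfolding source.sdp_def
      using group_presented_group sym_group_is_group target.group_sdp source.act_hom f
        target.perm_embedding_hom compat
      by (rule semidirect_hom[where f = f and k = ?k and \<phi> = source.act])
    show "\<forall>e\<in>index_pairs n. (\<lambda>(X, \<sigma>). f X \<otimes>\<^bsub>target.sdp\<^esub> ?k \<sigma>) (source.gen e, id) = target.twisted_gen e"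
      by (simp add: f_gen target.twisted_gen_closed flip: target.one_sdp)
    have "f \<one>\<^bsub>source.P\<^esub> = \<one>\<^bsub>target.sdp\<^esub>"
      using f by (rule hom_one) (simp_all add: group_presented_group target.group_sdp)
    then show "\<forall>\<sigma>. \<sigma> permutes {1..n} \<longrightarrow>
        (\<lambda>(X, \<sigma>). f X \<otimes>\<^bsub>target.sdp\<^esub> ?k \<sigma>) (\<one>\<^bsub>source.P\<^esub>, \<sigma>) = ?k \<sigma>"
      using hom_in_carrier[OF target.perm_embedding_hom] by (simp add: sym_group_carrier)
  qed
qed

end

text \<open>The recipe is its own inverse, so conditions on the relations in both directions give an
  isomorphism.\<close>

lemma twisted_iso:
  assumes "twisted_presentations n R R'" "twisted_presentations n R' R"
  shows "\<exists>h\<in>iso (symmetric_presentation.sdp n R) (symmetric_presentation.sdp n R').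
     (\<forall>e\<in>index_pairs n. h (presented_gen (index_pairs n) R e, id) =
        (presented_gen (index_pairs n) R' e, pair_swap e)) \<and>
     (\<forall>\<sigma>. \<sigma> permutes {1..n} \<longrightarrow> h (\<one>\<^bsub>presented_group (index_pairs n) R\<^esub>, \<sigma>) =
        (\<one>\<^bsub>presented_group (index_pairs n) R'\<^esub>, \<sigma>))"
proof -
  interpret fwd: twisted_presentations n R R' by fact
  interpret bwd: twisted_presentations n R' R by fact
  let ?A = "fwd.source.sdp" and ?B = "fwd.target.sdp"
  obtain h where h: "h \<in> hom ?A ?B"
    and h_gen: "\<And>e. e \<in> index_pairs n \<Longrightarrow> h (fwd.source.gen e, id) = fwd.target.twisted_gen e"
    and h_perm: "\<And>\<sigma>. \<sigma> permutes {1..n} \<Longrightarrow> h (\<one>\<^bsub>fwd.source.P\<^esub>, \<sigma>) = (\<one>\<^bsub>fwd.target.P\<^esub>, \<sigma>)"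
    using fwd.twisted_hom by blast
  obtain k where k: "k \<in> hom ?B ?A"
    and k_gen: "\<And>e. e \<in> index_pairs n \<Longrightarrow> k (fwd.target.gen e, id) = fwd.source.twisted_gen e"
    and k_perm: "\<And>\<sigma>. \<sigma> permutes {1..n} \<Longrightarrow> k (\<one>\<^bsub>fwd.target.P\<^esub>, \<sigma>) = (\<one>\<^bsub>fwd.source.P\<^esub>, \<sigma>)"
    using bwd.twisted_hom by blast
  \<comment> \<open>Each hom sends \<open>(e, swap) = (e, 1)(1, swap)\<close> to \<open>(e, swap)(1, swap) = (e, 1)\<close>.\<close>
  have untwist: "k' (symmetric_presentation.twisted_gen n T e) = (presented_gen (index_pairs n) T' e, id)"
    if "symmetric_presentation n T" "symmetric_presentation n T'"
      and k': "k' \<in> hom (symmetric_presentation.sdp n T) (symmetric_presentation.sdp n T')"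
      and k'_gen: "k' (presented_gen (index_pairs n) T e, id) = symmetric_presentation.twisted_gen n T' e"
      and k'_perm: "k' (\<one>\<^bsub>presented_group (index_pairs n) T\<^esub>, pair_swap e) =
        (\<one>\<^bsub>presented_group (index_pairs n) T'\<^esub>, pair_swap e)"
      and e: "e \<in> index_pairs n"
    for T T' k' e
  proof -
    interpret T: symmetric_presentation n T by fact
    interpret T': symmetric_presentation n T' by fact
    interpret P: group T.P by (rule group_presented_group)
    interpret P': group T'.P by (rule group_presented_group)
    note e_facts = presented_gen_carrier[OF e] pair_swap_permutes[OF e]
    have "T.twisted_gen e = (T.gen e, id) \<otimes>\<^bsub>T.sdp\<^esub> (\<one>\<^bsub>T.P\<^esub>, pair_swap e)"
      by (simp add: T.twisted_gen_def T.sdp_factor e_facts)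
    also have "k' \<dots> = T'.twisted_gen e \<otimes>\<^bsub>T'.sdp\<^esub> (\<one>\<^bsub>T'.P\<^esub>, pair_swap e)"
      by (subst hom_mult[OF k']) (simp_all add: T.carrier_sdp e_facts permutes_id k'_gen k'_perm)
    also have "\<dots> = (T'.gen e, id)"
      using e by (simp add: T'.twisted_gen_def T'.mult_sdp T'.act_one e_facts pair_swap_involutory)
    finally show ?thesis .
  qed
  have kh: "k (h x) = x" if "x \<in> carrier ?A" for x
  proof -
    have "(k \<circ> h) x = id x"
    proof (rule fwd.source.sdp_hom_unique[OF fwd.source.group_sdp hom_compose[OF h k] _ _ _ that])
      show "id \<in> hom ?A ?A" by (simp add: hom_def)
    qed (simp_all add: h_gen h_perm k_perm untwist[OF fwd.target.symmetric_presentation_axioms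
          fwd.source.symmetric_presentation_axioms k k_gen k_perm[OF pair_swap_permutes]])
    then show ?thesis by simp
  qed
  have hk: "h (k x) = x" if "x \<in> carrier ?B" for x
  proof -
    have "(h \<circ> k) x = id x"
    proof (rule fwd.target.sdp_hom_unique[OF fwd.target.group_sdp hom_compose[OF k h] _ _ _ that])
      show "id \<in> hom ?B ?B" by (simp add: hom_def)
    qed (simp_all add: k_gen h_perm k_perm untwist[OF fwd.source.symmetric_presentation_axioms
          fwd.target.symmetric_presentation_axioms h h_gen h_perm[OF pair_swap_permutes]])
    then show ?thesis by simp
  qed
  have "bij_betw h (carrier ?A) (carrier ?B)"
    by (rule bij_betw_byWitness[where f' = k]) (use kh hk hom_carrier[OF h] hom_carrier[OF k] in auto)
  then have "h \<in> iso ?A ?B" using h by (simp add: iso_def)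
  then show ?thesis using h_gen h_perm by (auto simp: fwd.target.twisted_gen_def)
qed


section \<open>The twisted relations\<close>

declare word_cong.trans [trans]

lemma word_cong_context:
  assumes "word_cong S R u v" "p \<in> words S" "q \<in> words S"
  shows "word_cong S R (p @ u @ q) (p @ v @ q)"
  using assms by (intro word_cong.append word_cong.refl)

lemma transpose_disjoint_commute:
  "{i, j} \<inter> {k, l} = {} \<Longrightarrow> transpose i j \<circ> transpose k l = transpose k l \<circ> transpose i j"
  by (auto simp: fun_eq_iff transpose_def)

text \<open>In these relations every swap meets only its own letter, which it fixes as an unordered pair,
  or a letter disjoint from it.\<close>

lemma twist_common_relation:
  assumes "(u, v) \<in> commutation_rels n \<union> involution_rels n"
  shows "twist u = u \<and> twist v = v \<and> swap_product u = swap_product v"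
  using assms
  by (auto simp: commutation_rels_def involution_rels_def distinct_indices_def letter_commute
      intro!: transpose_disjoint_commute)

lemma common_relation_words:
  assumes "(u, v) \<in> commutation_rels n \<union> involution_rels n"
  shows "u \<in> words (index_pairs n) \<and> v \<in> words (index_pairs n)"
  using assms
  by (auto simp: commutation_rels_def involution_rels_def distinct_indices_def letter_def
      index_pairsI)

lemma letter_square_cong:
  assumes "involution_rels n \<subseteq> R" "distinct_indices n [i, j]"
    "p \<in> words (index_pairs n)" "q \<in> words (index_pairs n)"
  shows "word_cong (index_pairs n) R (p @ letter i j # letter i j # q) (p @ q)"
proof -
  have "([letter i j, letter i j], []) \<in> involution_rels n"
    using assms(2) by (auto simp: involution_rels_def)
  then have "word_cong (index_pairs n) R [letter i j, letter i j] []"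
    using assms(1) common_relation_words by (blast intro: word_cong.rel)
  from word_cong_context[OF this assms(3,4)] show ?thesis by simp
qed

text \<open>\<open>(x y z)\<^sup>2 = x y z (z y x) = 1\<close> for \<open>x, y, z\<close> the letters \<open>ij, jk, ik\<close>.\<close>

lemma G2_triangle_square:
  assumes d: "distinct_indices n [i, j, k]"
  defines "x \<equiv> letter i j" and "y \<equiv> letter j k" and "z \<equiv> letter i k"
  shows "word_cong (index_pairs n) (G2_rels n) [x, y, z, x, y, z] []"
proof -
  let ?c = "word_cong (index_pairs n) (G2_rels n)"
  have w: "fst x \<in> index_pairs n" "fst y \<in> index_pairs n" "fst z \<in> index_pairs n"
    using d by (auto simp: assms(2-) distinct_indices_def letter_def intro: index_pairsI)
  have square: "?c (p @ l # l # q) (p @ q)"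
    if "l \<in> {x, y, z}" "p \<in> words (index_pairs n)" "q \<in> words (index_pairs n)" for l p q
  proof -
    have "involution_rels n \<subseteq> G2_rels n" by (auto simp: G2_rels_def)
    with that d show ?thesis
      by (auto simp: assms(2-) distinct_indices_def intro!: letter_square_cong)
  qed
  have "([x, y, z], [z, y, x]) \<in> G2_rels n"
  proof -
    have "distinct_indices n [j, i, k]" using d by (auto simp: distinct_indices_def)
    then have "([letter j i, letter j k, letter i k], [letter i k, letter j k, letter j i]) \<in> G2_rels n"
      unfolding G2_rels_def by blast
    then show ?thesis by (simp add: assms(2-) letter_commute[of i j])
  qed
  then have "?c [x, y, z] [z, y, x]" using w by (intro word_cong.rel) simp_all
  from word_cong_context[OF this, of "[x, y, z]" "[]"]
  have "?c [x, y, z, x, y, z] ([x, y] @ z # z # [y, x])" using w by simp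
  also have "?c \<dots> ([x, y] @ [y, x])"
    using w by (intro square) simp_all
  also have "[x, y] @ [y, x] = [x] @ y # y # [x]" by simp
  also have "?c \<dots> ([x] @ [x])"
    using w by (intro square) simp_all
  also have "[x] @ [x] = [] @ x # x # []" by simp
  also have "?c \<dots> ([] @ [])"
    using w by (intro square) simp_all
  finally show ?thesis by simp
qed

text \<open>\<open>y x y = (x y)\<^sup>3 y x y = x y x\<close> for \<open>x, y\<close> the letters \<open>ij, jk\<close>.\<close>

lemma C2_braid:
  assumes d: "distinct_indices n [i, j, k]"
  defines "x \<equiv> letter i j" and "y \<equiv> letter j k"
  shows "word_cong (index_pairs n) (C2_rels n) [x, y, x] [y, x, y]"
proof -
  let ?c = "word_cong (index_pairs n) (C2_rels n)"
  have w: "fst x \<in> index_pairs n" "fst y \<in> index_pairs n"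
    using d by (auto simp: assms(2-) distinct_indices_def letter_def intro: index_pairsI)
  have square: "?c (p @ l # l # q) (p @ q)"
    if "l \<in> {x, y}" "p \<in> words (index_pairs n)" "q \<in> words (index_pairs n)" for l p q
  proof -
    have "involution_rels n \<subseteq> C2_rels n" by (auto simp: C2_rels_def)
    with that d show ?thesis
      by (auto simp: assms(2-) distinct_indices_def intro!: letter_square_cong)
  qed
  have "(concat (replicate 3 [x, y]), []) \<in> C2_rels n"
  proof -
    have "distinct_indices n [j, i, k]" using d by (auto simp: distinct_indices_def)
    then have "(concat (replicate 3 [letter j i, letter j k]), []) \<in> C2_rels n"
      unfolding C2_rels_def by blast
    then show ?thesis by (simp only: assms(2-) letter_commute[of i j])
  qed
  then have "?c [x, y, x, y, x, y] []"
    using w by (intro word_cong.rel) (simp_all add: numeral_3_eq_3)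
  from word_cong.sym[OF word_cong_context[OF this, of "[]" "[y, x, y]"]]
  have "?c [y, x, y] ([x, y, x, y, x] @ y # y # [x, y])" using w by simp
  also have "?c \<dots> ([x, y, x, y, x] @ [x, y])"
    using w by (intro square) simp_all
  also have "[x, y, x, y, x] @ [x, y] = [x, y, x, y] @ x # x # [y]" by simp
  also have "?c \<dots> ([x, y, x, y] @ [y])"
    using w by (intro square) simp_all
  also have "[x, y, x, y] @ [y] = [x, y, x] @ y # y # []" by simp
  also have "?c \<dots> ([x, y, x] @ [])"
    using w by (intro square) simp_all
  finally show ?thesis by (simp add: word_cong.sym)
qed

lemma twisted_presentations_C2_G2: "twisted_presentations n (C2_rels n) (G2_rels n)"
proof unfold_locales
  fix u v assume uv: "(u, v) \<in> C2_rels n"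
  have "word_cong (index_pairs n) (G2_rels n) (twist u) (twist v) \<and> swap_product u = swap_product v"
  proof (cases "(u, v) \<in> commutation_rels n \<union> involution_rels n")
    case True
    then have "word_cong (index_pairs n) (G2_rels n) u v"
      using common_relation_words[OF True] by (intro word_cong.rel) (auto simp: G2_rels_def)
    with twist_common_relation[OF True] show ?thesis by simp
  next
    case False
    with uv obtain i j k where d: "distinct_indices n [i, j, k]"
      and u: "u = [letter i j, letter i k, letter i j, letter i k, letter i j, letter i k]"
      and v: "v = []"
      by (auto simp: C2_rels_def numeral_3_eq_3)
    have neq: "i \<noteq> j" "i \<noteq> k" "j \<noteq> k" "j \<noteq> i" "k \<noteq> i" "k \<noteq> j"
      using d by (auto simp: distinct_indices_def)
    note comm = letter_commute[of i j] letter_commute[of i k] letter_commute[of j k]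
    have "twist u = [letter i j, letter j k, letter i k, letter i j, letter j k, letter i k]"
      using neq by (simp add: u comm)
    moreover have "swap_product u = id"
      using neq by (auto simp: u fun_eq_iff transpose_def)
    ultimately show ?thesis using G2_triangle_square[OF d] by (simp add: v)
  qed
  then show "word_cong (index_pairs n) (G2_rels n) (twist u) (twist v)"
    "swap_product u = swap_product v" by simp_all
qed (rule C2_rels_relabel G2_rels_relabel; assumption)+

lemma twisted_presentations_G2_C2: "twisted_presentations n (G2_rels n) (C2_rels n)"
proof unfold_locales
  fix u v assume uv: "(u, v) \<in> G2_rels n"
  have "word_cong (index_pairs n) (C2_rels n) (twist u) (twist v) \<and> swap_product u = swap_product v"
  proof (cases "(u, v) \<in> commutation_rels n \<union> involution_rels n")
    case True
    then have "word_cong (index_pairs n) (C2_rels n) u v"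
      using common_relation_words[OF True] by (intro word_cong.rel) (auto simp: C2_rels_def)
    with twist_common_relation[OF True] show ?thesis by simp
  next
    case False
    with uv obtain i j k where d: "distinct_indices n [i, j, k]"
      and u: "u = [letter i j, letter i k, letter j k]"
      and v: "v = [letter j k, letter i k, letter i j]"
      by (auto simp: G2_rels_def)
    have neq: "i \<noteq> j" "i \<noteq> k" "j \<noteq> k" "j \<noteq> i" "k \<noteq> i" "k \<noteq> j"
      using d by (auto simp: distinct_indices_def)
    note comm = letter_commute[of i j] letter_commute[of i k] letter_commute[of j k]
    have "twist u = [letter i j, letter j k, letter i j]"
      "twist v = [letter j k, letter i j, letter j k]"
      using neq by (simp_all add: u v comm)
    moreover have "swap_product u = swap_product v"
      using neq by (auto simp: u v fun_eq_iff transpose_def)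
    ultimately show ?thesis using C2_braid[OF d] by simp
  qed
  then show "word_cong (index_pairs n) (C2_rels n) (twist u) (twist v)"
    "swap_product u = swap_product v" by simp_all
qed (rule C2_rels_relabel G2_rels_relabel; assumption)+


section \<open>The isomorphism\<close>

text \<open>The subgroup is the kernel of \<open>h\<close> followed by the projection to the acting group.\<close>

lemma semidirect_normal_preimage:
  assumes "group L" "group G" "group H" "\<phi> \<in> hom H (AutoGroup G)"
    and h: "h \<in> iso L (semidirect G H \<phi>)"
  shows "(inv_into (carrier L) h ` (carrier G \<times> {\<one>\<^bsub>H\<^esub>})) \<lhd> L"
proof -
  interpret H: group H by fact
  have h_hom: "h \<in> hom L (semidirect G H \<phi>)"
    and bij: "bij_betw h (carrier L) (carrier G \<times> carrier H)"
    using h by (auto simp: iso_def)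
  have "snd \<in> hom (semidirect G H \<phi>) H" by (rule homI) auto
  then interpret proj: group_hom L H "snd \<circ> h"
    using assms(1,3) hom_compose[OF h_hom] by (simp add: group_hom_def group_hom_axioms_def)
  have "inv_into (carrier L) h ` (carrier G \<times> {\<one>\<^bsub>H\<^esub>}) = kernel L H (snd \<circ> h)"
  proof (intro equalityI subsetI)
    fix x assume "x \<in> inv_into (carrier L) h ` (carrier G \<times> {\<one>\<^bsub>H\<^esub>})"
    then obtain g where g: "g \<in> carrier G" and x: "x = inv_into (carrier L) h (g, \<one>\<^bsub>H\<^esub>)" by blast
    have "(g, \<one>\<^bsub>H\<^esub>) \<in> h ` carrier L" using bij g by (simp add: bij_betw_def)
    then show "x \<in> kernel L H (snd \<circ> h)"
      by (simp add: x kernel_def f_inv_into_f inv_into_into)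
  next
    fix x assume "x \<in> kernel L H (snd \<circ> h)"
    then have x: "x \<in> carrier L" "snd (h x) = \<one>\<^bsub>H\<^esub>" by (auto simp: kernel_def)
    then have "h x \<in> carrier G \<times> {\<one>\<^bsub>H\<^esub>}" using bij_betwE[OF bij] by (auto simp: mem_Times_iff)
    moreover have "x = inv_into (carrier L) h (h x)"
      using bij x(1) by (simp add: bij_betw_def)
    ultimately show "x \<in> inv_into (carrier L) h ` (carrier G \<times> {\<one>\<^bsub>H\<^esub>})"
      by (rule rev_image_eqI)
  qed
  then show ?thesis using proj.normal_kernel by simp
qed

theorem theorem3:
  fixes n :: nat
  assumes "n > 2"
  shows "\<exists>h \<in> iso (C2_semidirect n) (G2_semidirect n).
      (\<forall>i\<in>{1..n}. \<forall>j\<in>{1..n}. i \<noteq> j \<longrightarrow> h (gen_b n i j, id) = (gen_a n i j, transpose i j)) \<and>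
      (\<forall>\<sigma>\<in>carrier (sym_group n). h (\<one>\<^bsub>C2 n\<^esub>, \<sigma>) = (\<one>\<^bsub>G2 n\<^esub>, \<sigma>)) \<and>
      (inv_into (carrier (C2_semidirect n)) h ` (carrier (G2 n) \<times> {id})) \<lhd> C2_semidirect n"
proof -
  interpret twisted_presentations n "C2_rels n" "G2_rels n" by (rule twisted_presentations_C2_G2)
  have sdp: "source.sdp = C2_semidirect n" "target.sdp = G2_semidirect n"
    by (simp_all add: source.sdp_def target.sdp_def C2_semidirect_def G2_semidirect_def C2_def G2_def
        C2_action_def[abs_def] G2_action_def[abs_def])
  obtain h where h: "h \<in> iso (C2_semidirect n) (G2_semidirect n)"
    and gens: "\<And>e. e \<in> index_pairs n \<Longrightarrow> h (source.gen e, id) = (target.gen e, pair_swap e)"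
    and perms: "\<And>\<sigma>. \<sigma> permutes {1..n} \<Longrightarrow> h (\<one>\<^bsub>C2 n\<^esub>, \<sigma>) = (\<one>\<^bsub>G2 n\<^esub>, \<sigma>)"
    using twisted_iso[OF twisted_presentations_C2_G2 twisted_presentations_G2_C2, of n, unfolded sdp]
    unfolding C2_def G2_def by blast
  have "(inv_into (carrier (C2_semidirect n)) h ` (carrier (G2 n) \<times> {id})) \<lhd> C2_semidirect n"
    using semidirect_normal_preimage[OF group_C2_semidirect group_G2 sym_group_is_group G2_action_hom]
      h by (simp add: G2_semidirect_def sym_group_one)
  with h show ?thesis
    by (intro bexI[of _ h] conjI)
      (auto simp: gen_a_def gen_b_def gens index_pairsI perms sym_group_carrier)
qed

end
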